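(* Let $G$ be a finite simple graph without isolated vertices. Then $G$ has at least one total restrained coalition partition, and $C_{tr}(G)\ge 2\,d_t^r(G)$.
   Context: For a graph $G=(V,E)$, a set $S\subseteq V$ is a total restrained dominating set (TRD-set) if every vertex of $V\setminus S$ is adjacent to at least one vertex of $S$ and to at least one other vertex of $V\setminus S$, and every vertex of $S$ is adjacent to at least one other vertex of $S$. Two disjoint sets $X,Y\subseteq V$ form a total restrained coalition if neither $X$ nor $Y$ is a TRD-set but $X\cup Y$ is a TRD-set. A total restrained coalition partition (trc-partition) of $G$ is a partition $\Phi=\{V_1,\dots,V_k\}$ of $V$ such that no $V_i$ is a TRD-set and each $V_i$ forms a total restrained coalition with some other $V_j\in\Phi$. $C_{tr}(G)$ denotes the maximum cardinality of a trc-partition of $G$. The total restrained domatic number $d_t^r(G)$ is the maximum number of sets in a partition of $V$ into TRD-sets. *)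

theory Defs
  imports "Graph_Theory.Graph_Theory" "HOL-Library.Disjoint_Sets"
begin

(* Finite simple graphs are those satisfying the locale predicate pair_graph: finite, loopfree,
   symmetric pair digraphs, where adjacency of u and v is (u, v) : parcs G. *)

definition no_isolated_vertices :: "'a pair_pre_digraph \<Rightarrow> bool" where
  "no_isolated_vertices G \<longleftrightarrow> (\<forall>v \<in> pverts G. \<exists>u \<in> pverts G. (v, u) \<in> parcs G)"

definition trd_set :: "'a pair_pre_digraph \<Rightarrow> 'a set \<Rightarrow> bool" where
  "trd_set G S \<longleftrightarrow> S \<subseteq> pverts G \<and>
     (\<forall>v \<in> pverts G - S. (\<exists>u \<in> S. (v, u) \<in> parcs G) \<and>
                         (\<exists>w \<in> pverts G - S. w \<noteq> v \<and> (v, w) \<in> parcs G)) \<and>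
     (\<forall>v \<in> S. \<exists>u \<in> S. u \<noteq> v \<and> (v, u) \<in> parcs G)"

definition tr_coalition :: "'a pair_pre_digraph \<Rightarrow> 'a set \<Rightarrow> 'a set \<Rightarrow> bool" where
  "tr_coalition G X Y \<longleftrightarrow> X \<subseteq> pverts G \<and> Y \<subseteq> pverts G \<and> X \<inter> Y = {} \<and>
     \<not> trd_set G X \<and> \<not> trd_set G Y \<and> trd_set G (X \<union> Y)"

definition trc_partition :: "'a pair_pre_digraph \<Rightarrow> 'a set set \<Rightarrow> bool" where
  "trc_partition G \<Phi> \<longleftrightarrow> partition_on (pverts G) \<Phi> \<and>
     (\<forall>X \<in> \<Phi>. \<not> trd_set G X \<and> (\<exists>Y \<in> \<Phi>. Y \<noteq> X \<and> tr_coalition G X Y))"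

definition trd_partition :: "'a pair_pre_digraph \<Rightarrow> 'a set set \<Rightarrow> bool" where
  "trd_partition G P \<longleftrightarrow> partition_on (pverts G) P \<and> (\<forall>S \<in> P. trd_set G S)"

(* Max of the empty set is unspecified, so the next two constants are meaningful only when
   a partition of the respective kind exists. *)

definition C_tr :: "'a pair_pre_digraph \<Rightarrow> nat" where
  "C_tr G = Max {card \<Phi> | \<Phi>. trc_partition G \<Phi>}"

definition tr_domatic_number :: "'a pair_pre_digraph \<Rightarrow> nat" where
  "tr_domatic_number G = Max {card P | P. trd_partition G P}"

(* For finite G both maxima range over finite sets, and without isolated vertices
   the one in tr_domatic_number ranges over a nonempty set. *)

lemma finite_card_trc_partitions:
  assumes "finite (pverts G)"
  shows "finite {card \<Phi> | \<Phi>. trc_partition G \<Phi>}"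
proof -
  have "{\<Phi>. trc_partition G \<Phi>} \<subseteq> Pow (Pow (pverts G))"
    unfolding trc_partition_def partition_on_def by blast
  then have "finite {\<Phi>. trc_partition G \<Phi>}"
    by (rule finite_subset) (simp add: assms)
  then show ?thesis by simp
qed

lemma finite_card_trd_partitions:
  assumes "finite (pverts G)"
  shows "finite {card P | P. trd_partition G P}"
proof -
  have "{P. trd_partition G P} \<subseteq> Pow (Pow (pverts G))"
    unfolding trd_partition_def partition_on_def by blast
  then have "finite {P. trd_partition G P}"
    by (rule finite_subset) (simp add: assms)
  then show ?thesis by simp
qed

lemma trd_partition_exists:
  assumes "pair_graph G" and "no_isolated_vertices G"
  shows "\<exists>P. trd_partition G P"
proof -
  have "\<exists>u \<in> pverts G. u \<noteq> v \<and> (v, u) \<in> parcs G" if "v \<in> pverts G" for v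
  proof -
    obtain u where "u \<in> pverts G" "(v, u) \<in> parcs G"
      using assms(2) \<open>v \<in> pverts G\<close> unfolding no_isolated_vertices_def by blast
    moreover have "v \<noteq> u"
      using pair_loopfree_digraph.no_loops'[of G v u] \<open>(v, u) \<in> parcs G\<close> assms(1)
      by (simp add: pair_graph_def pair_digraph_def)
    ultimately show ?thesis by metis
  qed
  then have V: "trd_set G (pverts G)"
    unfolding trd_set_def by blast
  show ?thesis
  proof (cases "pverts G = {}")
    case True
    then have "trd_partition G {}"
      by (simp add: trd_partition_def partition_on_empty)
    then show ?thesis ..
  next
    case False
    then have "trd_partition G {pverts G}"
      using V by (simp add: trd_partition_def partition_on_def)
    then show ?thesis ..
  qed
qed

end

theory Submission
  imports Defs
begin

text \<open>
  Take a partition of the vertex set into as many TRD-sets as possible. By maximality no block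
  \<open>S\<close> is a disjoint union of two TRD-sets. Choose a minimal TRD-set \<open>T\<close> inside \<open>S\<close>, a vertex
  \<open>v \<in> T\<close>, and put \<open>R = S - T\<close>. Then none of \<open>{v}\<close>, \<open>T - {v}\<close> and \<open>R\<close> is a TRD-set. If \<open>R\<close> is
  empty, \<open>{v}\<close> and \<open>T - {v}\<close> form a coalition; if \<open>R \<union> {v}\<close> is a TRD-set, then both \<open>T - {v}\<close> and
  \<open>R\<close> are partners of \<open>{v}\<close>; otherwise \<open>R \<union> {v}\<close> and \<open>T - {v}\<close> form a coalition. So every block
  breaks up into at least two coalition members.
\<close>

text \<open>\<open>P\<close> will be instantiated by "nonempty TRD-set". Closure under supersets is
  not assumed, and TRD-sets lack it: a vertex left outside also needs a neighbour outside.\<close>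

lemma split_into_partners:
  fixes P :: "'a set \<Rightarrow> bool"
  assumes "finite S" "P S"
    and empty: "\<not> P {}" and single: "\<And>v. \<not> P {v}"
    and unsplittable: "\<And>A B. A \<union> B = S \<Longrightarrow> A \<inter> B = {} \<Longrightarrow> P A \<Longrightarrow> \<not> P B"
  shows "\<exists>Q. partition_on S Q \<and> 2 \<le> card Q \<and>
    (\<forall>X \<in> Q. \<not> P X \<and> (\<exists>Y \<in> Q. Y \<noteq> X \<and> P (X \<union> Y)))"
proof -
  have two_parts: ?thesis
    if "A \<union> B = S" "A \<inter> B = {}" "\<not> P A" "\<not> P B" for A B
  proof -
    \<comment> \<open>If one part were empty, the other would be \<open>S\<close>, which satisfies
      \<open>P\<close>.\<close>
    have "A \<noteq> {}" "B \<noteq> {}"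
      using that \<open>P S\<close> by auto
    then have "A \<noteq> B"
      using that(2) by auto
    have "partition_on S {A, B}"
      using that \<open>A \<noteq> {}\<close> \<open>B \<noteq> {}\<close> by (auto simp: partition_on_def disjoint_def)
    moreover have "P (A \<union> B)" "P (B \<union> A)"
      using that(1) \<open>P S\<close> by (auto simp: Un_commute)
    ultimately show ?thesis
      using that \<open>A \<noteq> B\<close> by (intro exI[of _ "{A, B}"]) auto
  qed
  have "finite {T. T \<subseteq> S \<and> P T}"
    using \<open>finite S\<close> by simp
  moreover have "{T. T \<subseteq> S \<and> P T} \<noteq> {}"
    using \<open>P S\<close> by auto
  ultimately obtain T where T: "T \<subseteq> S" "P T"
    and "\<forall>U \<in> {T. T \<subseteq> S \<and> P T}. U \<subseteq> T \<longrightarrow> T = U"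
    by (metis (no_types, lifting) finite_has_minimal mem_Collect_eq)
  then have minimal: "\<not> P U" if "U \<subset> T" for U
    using that by auto
  obtain v where "v \<in> T"
    using T(2) empty by (metis all_not_in_conv)
  define B where "B = T - {v}"
  define R where "R = S - T"
  have "\<not> P B"
    using minimal \<open>v \<in> T\<close> B_def by blast
  have "\<not> P R"
    using unsplittable[of T R] T by (auto simp: R_def)
  have "P (insert v B)"
    using T(2) \<open>v \<in> T\<close> by (simp add: B_def insert_absorb)
  \<comment> \<open>Otherwise \<open>insert v B\<close> would be a singleton.\<close>
  then have "B \<noteq> {}"
    using single by auto
  show ?thesis
  proof (cases "R \<noteq> {} \<and> P (insert v R)")
    case True
    have disj: "v \<notin> B" "v \<notin> R" "B \<inter> R = {}"
      using \<open>v \<in> T\<close> by (auto simp: B_def R_def)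
    then have neq: "{v} \<noteq> B" "{v} \<noteq> R" "B \<noteq> R"
      using \<open>B \<noteq> {}\<close> by auto
    have "\<Union> {{v}, B, R} = S"
      using T(1) \<open>v \<in> T\<close> by (auto simp: B_def R_def)
    then have "partition_on S {{v}, B, R}"
      using disj True \<open>B \<noteq> {}\<close> by (auto simp: partition_on_def disjoint_def)
    then show ?thesis
      using True neq single \<open>\<not> P B\<close> \<open>\<not> P R\<close> \<open>P (insert v B)\<close>
      by (intro exI[of _ "{{v}, B, R}"]) auto
  next
    case False
    \<comment> \<open>For empty \<open>R\<close> this set is the singleton of \<open>v\<close>, so
      the same split into two parts serves both ways in which the case condition can fail.\<close>
    then have "\<not> P (insert v R)"
      using single by auto
    then show ?thesis
      using two_parts[of "insert v R" B] \<open>\<not> P B\<close> T(1) \<open>v \<in> T\<close>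
      by (auto simp: B_def R_def)
  qed
qed

lemma partition_on_refine:
  assumes P: "partition_on A P" and f: "\<And>S. S \<in> P \<Longrightarrow> partition_on S (f S)"
  shows "partition_on A (\<Union>S\<in>P. f S)"
proof (rule partition_onI)
  have Union_f: "\<Union> (f S) = S" if "S \<in> P" for S
    using partition_onD1[OF f[OF that]] by (rule sym)
  then show "\<Union> (\<Union>S\<in>P. f S) = A"
    using partition_onD1[OF P] by blast
  show "{} \<notin> (\<Union>S\<in>P. f S)"
    using partition_onD3[OF f] by blast
  fix p q assume "p \<in> (\<Union>S\<in>P. f S)" "q \<in> (\<Union>S\<in>P. f S)" "p \<noteq> q"
  then obtain S T where ST: "S \<in> P" "p \<in> f S" "T \<in> P" "q \<in> f T"
    by blast
  show "disjnt p q"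
  proof (cases "S = T")
    case True
    then show ?thesis
      using ST \<open>p \<noteq> q\<close> partition_onD2[OF f[OF \<open>S \<in> P\<close>]]
      by (auto simp: disjoint_def disjnt_def)
  next
    case False
    then have "S \<inter> T = {}"
      using ST partition_onD2[OF P] by (simp add: disjoint_def)
    moreover have "p \<subseteq> S" "q \<subseteq> T"
      using ST Union_f by blast+
    ultimately show ?thesis
      by (auto simp: disjnt_def)
  qed
qed

text \<open>The families \<open>f S\<close> are pairwise disjoint, so their cardinalities add up: a
  common member of two of them would be a nonempty subset of two disjoint blocks.\<close>

lemma card_refinement_ge:
  assumes P: "partition_on A P" and "finite A"
    and f: "\<And>S. S \<in> P \<Longrightarrow> partition_on S (f S)" and k: "\<And>S. S \<in> P \<Longrightarrow> k \<le> card (f S)"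
  shows "k * card P \<le> card (\<Union>S\<in>P. f S)"
proof -
  have "finite P"
    using finite_elements[OF \<open>finite A\<close> P] .
  have "finite (f S)" if "S \<in> P" for S
    using that P f \<open>finite A\<close> by (metis Sup_upper finite_elements finite_subset partition_onD1)
  moreover have "f S \<inter> f T = {}" if "S \<in> P" "T \<in> P" "S \<noteq> T" for S T
  proof -
    have "S \<inter> T = {}"
      using partition_onD2[OF P] that by (auto simp: disjoint_def)
    moreover have "X \<subseteq> S \<inter> T" if "X \<in> f S" "X \<in> f T" for X
      using that partition_onD1[OF f[OF \<open>S \<in> P\<close>]] partition_onD1[OF f[OF \<open>T \<in> P\<close>]] by blast
    ultimately show ?thesis
      using partition_onD3[OF f[OF \<open>S \<in> P\<close>]] by fastforce
  qed
  ultimately have "card (\<Union>S\<in>P. f S) = (\<Sum>S\<in>P. card (f S))"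
    using \<open>finite P\<close> by (intro card_UN_disjoint) auto
  also have "\<dots> \<ge> (\<Sum>S\<in>P. k)"
    by (intro sum_mono k)
  finally show ?thesis
    by (simp add: mult.commute)
qed

text \<open>Trading one block for two contradicts maximality; this supplies the hypothesis
  \<open>unsplittable\<close> of \<open>split_into_partners\<close>.\<close>

lemma trd_partition_split_block:
  assumes P: "trd_partition G P" and "finite (pverts G)" and "A \<union> B \<in> P" "A \<inter> B = {}"
    and "trd_set G A" "trd_set G B" "A \<noteq> {}" "B \<noteq> {}"
  shows "\<exists>P'. trd_partition G P' \<and> card P' = Suc (card P)"
proof -
  have part: "partition_on (pverts G) P"
    using P by (simp add: trd_partition_def)
  define P' where "P' = insert A (insert B (P - {A \<union> B}))"
  have disj: "X \<inter> (A \<union> B) = {}" if "X \<in> P" "X \<noteq> A \<union> B" for X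
    using partition_onD2[OF part] that \<open>A \<union> B \<in> P\<close> by (auto simp: disjoint_def)
  \<comment> \<open>The other blocks miss \<open>A \<union> B\<close>, so the nonempty sets
    \<open>A\<close> and \<open>B\<close> are not among them, and both insertions increase the
    cardinality.\<close>
  have "A \<notin> P - {A \<union> B}" "B \<notin> P - {A \<union> B}" "A \<noteq> B"
    using disj assms by blast+
  moreover have "finite P"
    using finite_elements[OF \<open>finite (pverts G)\<close> part] .
  ultimately have "card P' = Suc (Suc (card (P - {A \<union> B})))"
    by (simp add: P'_def)
  then have "card P' = Suc (card P)"
    using card_Suc_Diff1[OF \<open>finite P\<close> \<open>A \<union> B \<in> P\<close>] by simp
  moreover have "partition_on (pverts G) P'"
  proof (rule partition_onI)
    show "\<Union> P' = pverts G"
      using partition_onD1[OF part] \<open>A \<union> B \<in> P\<close> by (auto simp: P'_def)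
    show "{} \<notin> P'"
      using partition_onD3[OF part] assms(7,8) by (auto simp: P'_def)
    have block: "disjnt A X" "disjnt B X" if "X \<in> P - {A \<union> B}" for X
      using disj[of X] that by (auto simp: disjnt_def)
    have rest: "disjnt X Y" if "X \<in> P - {A \<union> B}" "Y \<in> P - {A \<union> B}" "X \<noteq> Y" for X Y
      using partition_onD2[OF part] that by (simp add: disjoint_def disjnt_def)
    have "disjnt A B"
      using \<open>A \<inter> B = {}\<close> by (simp add: disjnt_def)
    then show "disjnt p q" if "p \<in> P'" "q \<in> P'" "p \<noteq> q" for p q
      using that block rest unfolding P'_def by (metis disjnt_sym insert_iff)
  qed
  then have "trd_partition G P'"
    using P assms(5,6) by (auto simp: trd_partition_def P'_def)
  ultimately show ?thesis
    by blast
qed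

lemma trc_partition_from_trd_partition:
  assumes "finite (pverts G)" and P: "trd_partition G P"
    and maximal: "\<And>P'. trd_partition G P' \<Longrightarrow> card P' \<le> card P"
  shows "\<exists>\<Phi>. trc_partition G \<Phi> \<and> 2 * card P \<le> card \<Phi>"
proof -
  have part: "partition_on (pverts G) P" and trd: "\<And>S. S \<in> P \<Longrightarrow> trd_set G S"
    using P by (auto simp: trd_partition_def)
  \<comment> \<open>The empty set satisfies \<^const>\<open>trd_set\<close> when the graph has no vertices.\<close>
  let ?trd = "\<lambda>S. S \<noteq> {} \<and> trd_set G S"
  have "\<exists>Q. partition_on S Q \<and> 2 \<le> card Q \<and>
      (\<forall>X \<in> Q. \<not> ?trd X \<and> (\<exists>Y \<in> Q. Y \<noteq> X \<and> ?trd (X \<union> Y)))" if "S \<in> P" for S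
  proof (rule split_into_partners)
    show "finite S"
      using that part assms(1) by (metis Sup_upper finite_subset partition_onD1)
    show "?trd S"
      using that trd partition_onD3[OF part] by auto
    \<comment> \<open>Each vertex of a TRD-set needs a neighbour in the set other than
      itself.\<close>
    show "\<not> ?trd {v}" for v
      by (auto simp: trd_set_def)
    show "\<not> ?trd B" if "A \<union> B = S" "A \<inter> B = {}" "?trd A" for A B
      using trd_partition_split_block[OF P assms(1), of A B] maximal that \<open>S \<in> P\<close>
      by fastforce
  qed simp
  then obtain f where f: "\<And>S. S \<in> P \<Longrightarrow> partition_on S (f S)"
    and card_f: "\<And>S. S \<in> P \<Longrightarrow> 2 \<le> card (f S)"
    and partner: "\<And>S X. S \<in> P \<Longrightarrow> X \<in> f S \<Longrightarrow>
      \<not> ?trd X \<and> (\<exists>Y \<in> f S. Y \<noteq> X \<and> ?trd (X \<union> Y))"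
    by metis
  let ?\<Phi> = "\<Union>S\<in>P. f S"
  have \<Phi>: "partition_on (pverts G) ?\<Phi>"
    using partition_on_refine[OF part f] .
  \<comment> \<open>Blocks are nonempty, so failing \<open>?trd\<close> means failing
    \<open>trd_set\<close>.\<close>
  have not_trd: "\<not> trd_set G X" if "X \<in> ?\<Phi>" for X
    using that partner partition_onD3[OF \<Phi>] by (metis UN_E)
  have "\<exists>Y \<in> ?\<Phi>. Y \<noteq> X \<and> tr_coalition G X Y" if "X \<in> ?\<Phi>" for X
  proof -
    \<comment> \<open>The partner comes from the family \<open>f S\<close> that contains
      \<open>X\<close>, so the coalition stays inside one block of \<open>P\<close>.\<close>
    obtain Y where Y: "Y \<in> ?\<Phi>" "Y \<noteq> X" "trd_set G (X \<union> Y)"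
      using \<open>X \<in> ?\<Phi>\<close> partner by (metis UN_E UN_I)
    then have "X \<inter> Y = {}"
      using partition_onD2[OF \<Phi>] that by (metis disjointD)
    moreover have "X \<subseteq> pverts G" "Y \<subseteq> pverts G"
      using Y(3) by (auto simp: trd_set_def)
    ultimately have "tr_coalition G X Y"
      using Y not_trd that by (simp add: tr_coalition_def)
    then show ?thesis
      using Y by blast
  qed
  then have "trc_partition G ?\<Phi>"
    using \<Phi> not_trd by (simp add: trc_partition_def)
  then show ?thesis
    using card_refinement_ge[OF part assms(1) f card_f] by blast
qed

theorem theorem2p3:
  fixes G :: "'a pair_pre_digraph"
  assumes "pair_graph G"
    and "no_isolated_vertices G"
  shows "(\<exists>\<Phi>. trc_partition G \<Phi>) \<and> C_tr G \<ge> 2 * tr_domatic_number G"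
proof -
  have fin: "finite (pverts G)"
    using assms(1) by (simp add: pair_graph_def pair_digraph_def pair_fin_digraph.pair_finite_verts)
  \<comment> \<open>The maximum is attained: the set of cardinalities is finite, and it is nonempty
    because there are no isolated vertices.\<close>
  have "tr_domatic_number G \<in> {card P | P. trd_partition G P}"
    unfolding tr_domatic_number_def
    using finite_card_trd_partitions[OF fin] trd_partition_exists[OF assms]
    by (intro Max_in) auto
  then obtain P where P: "trd_partition G P" "card P = tr_domatic_number G"
    by auto
  have "card P' \<le> card P" if "trd_partition G P'" for P'
    unfolding P(2) tr_domatic_number_def
    using finite_card_trd_partitions[OF fin] that by (intro Max_ge) auto
  \<comment> \<open>This includes the graph without vertices, where \<open>P\<close> and
    \<open>\<Phi>\<close> are both empty.\<close>
  then obtain \<Phi> where \<Phi>: "trc_partition G \<Phi>" "2 * card P \<le> card \<Phi>"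
    using trc_partition_from_trd_partition[OF fin P(1)] by blast
  have "card \<Phi> \<le> C_tr G"
    unfolding C_tr_def
    using finite_card_trc_partitions[OF fin] \<Phi>(1) by (intro Max_ge) auto
  then show ?thesis
    using \<Phi> P(2) by fastforce
qed

end
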